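(* For every $n\geq3$, $|P(T,n\times n)|=|P(S,n\times n)|$.
   Context: Let $\mathcal{A}=\{\mathtt{A},\dots,\mathtt{P}\}$, $\mathcal{B}=\{\mathtt{0},\mathtt{1},\mathtt{2},\mathtt{3}\}$. The substitution $\mu$ maps each letter to a $2\times2$ block over $\mathcal{A}$ (written (first row / second row)): $\mathtt{A}\mapsto(\mathtt{AF}/\mathtt{GC})$, $\mathtt{B}\mapsto(\mathtt{AF}/\mathtt{HD})$, $\mathtt{C}\mapsto(\mathtt{BE}/\mathtt{GC})$, $\mathtt{D}\mapsto(\mathtt{BE}/\mathtt{HD})$, $\mathtt{E}\mapsto(\mathtt{AN}/\mathtt{GK})$, $\mathtt{F}\mapsto(\mathtt{AN}/\mathtt{HL})$, $\mathtt{G}\mapsto(\mathtt{BM}/\mathtt{GK})$, $\mathtt{H}\mapsto(\mathtt{BM}/\mathtt{HL})$, $\mathtt{I}\mapsto(\mathtt{IF}/\mathtt{OC})$, $\mathtt{J}\mapsto(\mathtt{IF}/\mathtt{PD})$, $\mathtt{K}\mapsto(\mathtt{JE}/\mathtt{OC})$, $\mathtt{L}\mapsto(\mathtt{JE}/\mathtt{PD})$, $\mathtt{M}\mapsto(\mathtt{IN}/\mathtt{OK})$, $\mathtt{N}\mapsto(\mathtt{IN}/\mathtt{PL})$, $\mathtt{O}\mapsto(\mathtt{JM}/\mathtt{OK})$, $\mathtt{P}\mapsto(\mathtt{JM}/\mathtt{PL})$. The map $\phi$ from $\mathcal{A}$ to $2\times2$ blocks over $\mathcal{B}$: $\mathtt{A}\mapsto(01/00)$,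 $\mathtt{B}\mapsto(01/11)$, $\mathtt{C}\mapsto(10/00)$, $\mathtt{D}\mapsto(10/11)$, $\mathtt{E}\mapsto(03/02)$, $\mathtt{F}\mapsto(03/13)$, $\mathtt{G}\mapsto(12/02)$, $\mathtt{H}\mapsto(12/13)$, $\mathtt{I}\mapsto(21/20)$, $\mathtt{J}\mapsto(21/31)$, $\mathtt{K}\mapsto(30/20)$, $\mathtt{L}\mapsto(30/31)$, $\mathtt{M}\mapsto(23/22)$, $\mathtt{N}\mapsto(23/33)$, $\mathtt{O}\mapsto(32/22)$, $\mathtt{P}\mapsto(32/33)$. For a matrix $X$ over $\mathcal{A}$, $\mu(X)$ and $\phi(X)$ replace each entry by its $2\times 2$ block; $\mu^0=\mathrm{id}$, $\mu^k=\mu^{k-1}\circ\mu$; $T_k:=\mu^k(\mathtt{N})$. For a matrix $X$, $P(X,m\times n)$ is the set of all its $m\times n$ contiguous submatrices. Put $P(T,m\times n):=\bigcup_{k\ge0}P(T_k,m\times n)$ and $P(S,m\times n):=\bigcup_{k\ge0}P(\phi(T_k),m\times n)$. *)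

theory Defs
  imports "Jordan_Normal_Form.Matrix"
begin

datatype letter =
  LA | LB | LC | LD | LE | LF | LG | LH | LI | LJ | LK | LL | LM | LN | LO | LP

datatype digit = D0 | D1 | D2 | D3

definition block :: "'a \<Rightarrow> 'a \<Rightarrow> 'a \<Rightarrow> 'a \<Rightarrow> 'a mat" where
  "block a b c d = mat_of_rows_list 2 [[a, b], [c, d]]"

primrec mu :: "letter \<Rightarrow> letter mat" where
  "mu LA = block LA LF LG LC"
| "mu LB = block LA LF LH LD"
| "mu LC = block LB LE LG LC"
| "mu LD = block LB LE LH LD"
| "mu LE = block LA LN LG LK"
| "mu LF = block LA LN LH LL"
| "mu LG = block LB LM LG LK"
| "mu LH = block LB LM LH LL"
| "mu LI = block LI LF LO LC"
| "mu LJ = block LI LF LP LD"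
| "mu LK = block LJ LE LO LC"
| "mu LL = block LJ LE LP LD"
| "mu LM = block LI LN LO LK"
| "mu LN = block LI LN LP LL"
| "mu LO = block LJ LM LO LK"
| "mu LP = block LJ LM LP LL"

primrec phi :: "letter \<Rightarrow> digit mat" where
  "phi LA = block D0 D1 D0 D0"
| "phi LB = block D0 D1 D1 D1"
| "phi LC = block D1 D0 D0 D0"
| "phi LD = block D1 D0 D1 D1"
| "phi LE = block D0 D3 D0 D2"
| "phi LF = block D0 D3 D1 D3"
| "phi LG = block D1 D2 D0 D2"
| "phi LH = block D1 D2 D1 D3"
| "phi LI = block D2 D1 D2 D0"
| "phi LJ = block D2 D1 D3 D1"
| "phi LK = block D3 D0 D2 D0"
| "phi LL = block D3 D0 D3 D1"
| "phi LM = block D2 D3 D2 D2"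
| "phi LN = block D2 D3 D3 D3"
| "phi LO = block D3 D2 D2 D2"
| "phi LP = block D3 D2 D3 D3"

(* Only meaningful when every f a is a 2 x 2 matrix. *)
definition apply_subst :: "('a \<Rightarrow> 'b mat) \<Rightarrow> 'a mat \<Rightarrow> 'b mat" where
  "apply_subst f X = mat (2 * dim_row X) (2 * dim_col X)
     (\<lambda>(i, j). f (X $$ (i div 2, j div 2)) $$ (i mod 2, j mod 2))"

definition T :: "nat \<Rightarrow> letter mat" where
  "T k = (apply_subst mu ^^ k) (mat 1 1 (\<lambda>_. LN))"

definition patterns :: "'a mat \<Rightarrow> nat \<Rightarrow> nat \<Rightarrow> 'a mat set" where
  "patterns X m n = {mat m n (\<lambda>(i, j). X $$ (r + i, c + j)) | r c.
     r + m \<le> dim_row X \<and> c + n \<le> dim_col X}"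

definition patterns_T :: "nat \<Rightarrow> nat \<Rightarrow> letter mat set" where
  "patterns_T m n = (\<Union>k. patterns (T k) m n)"

definition patterns_S :: "nat \<Rightarrow> nat \<Rightarrow> digit mat set" where
  "patterns_S m n = (\<Union>k. patterns (apply_subst phi (T k)) m n)"

end

theory Submission
  imports Defs
begin

text \<open>
  Replacing every letter by a suitable digit turns \<open>\<mu>\<close> into \<open>\<phi>\<close>, so the patterns of \<open>S\<close> are the
  digit images of those of \<open>T\<close>, and the task is to show that passing to digits is injective on
  square patterns of size at least 3. From \<open>T\<^sub>1\<close> on, a letter of \<open>T\<^sub>k\<close> is determined by the parities
  of its row and column together with its digit; hence it suffices to recover the parities of the
  upper left corner of a pattern from its digits. Write a digit in binary. In even rows the low
  bits alternate, while in odd rows they come in equal pairs, so three consecutive digits reveal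
  the parity of their row. The column parity is read off the high bits across a step from an odd
  row to an even row: they always change in odd columns, and in an even column they can change
  only if the even row is divisible by 4, in which case its low bits are the column parities.
\<close>

section \<open>Digits and parities of letters\<close>

primrec digit_of :: "letter \<Rightarrow> digit" where
  "digit_of LA = D0"
| "digit_of LB = D1"
| "digit_of LC = D0"
| "digit_of LD = D1"
| "digit_of LE = D0"
| "digit_of LF = D1"
| "digit_of LG = D0"
| "digit_of LH = D1"
| "digit_of LI = D2"
| "digit_of LJ = D3"
| "digit_of LK = D2"
| "digit_of LL = D3"
| "digit_of LM = D2"
| "digit_of LN = D3"
| "digit_of LO = D2"
| "digit_of LP = D3"

definition hi :: "digit \<Rightarrow> bool" where
  "hi d \<longleftrightarrow> d \<in> {D2, D3}"

definition lo :: "digit \<Rightarrow> bool" where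
  "lo d \<longleftrightarrow> d \<in> {D1, D3}"

text \<open>Each letter occurs in only one of the four places of the blocks of \<open>mu\<close>.
  The row of that place decides membership here, and its column decides
  \<open>col_odd\<close>.\<close>

definition row_odd :: "letter \<Rightarrow> bool" where
  "row_odd x \<longleftrightarrow> x \<in> {LC, LD, LG, LH, LK, LL, LO, LP}"

definition col_odd :: "letter \<Rightarrow> bool" where
  "col_odd x \<longleftrightarrow> x \<in> {LC, LD, LE, LF, LK, LL, LM, LN}"

text \<open>Each of the four parity classes has four letters, with distinct digits.\<close>

lemma letter_eqI:
  assumes "row_odd x = row_odd y" "col_odd x = col_odd y" "digit_of x = digit_of y"
  shows "x = y"
  using assms by (cases x; cases y; simp add: row_odd_def col_odd_def)

lemma block_index [simp]:
  "block a b c d $$ (0, 0) = a"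
  "block a b c d $$ (0, Suc 0) = b"
  "block a b c d $$ (Suc 0, 0) = c"
  "block a b c d $$ (Suc 0, Suc 0) = d"
  by (simp_all add: block_def mat_of_rows_list_def)

lemma mod_2_cases:
  fixes i :: nat
  obtains "even i" "i mod 2 = 0" | "odd i" "i mod 2 = Suc 0"
  by (cases "even i") (auto simp: even_iff_mod_2_eq_zero odd_iff_mod_2_eq_one)

lemma phi_index: "phi x $$ (i mod 2, j mod 2) = digit_of (mu x $$ (i mod 2, j mod 2))"
  by (cases i rule: mod_2_cases; cases j rule: mod_2_cases; cases x; simp)

text \<open>A bit that is not inherited from \<open>x\<close> depends on parities only. This is what
  makes closed formulas for such bits in \<open>T (Suc (Suc k))\<close> possible.\<close>

lemma mu_index:
  shows row_odd_mu: "row_odd (mu x $$ (i mod 2, j mod 2)) \<longleftrightarrow> odd i"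
    and col_odd_mu: "col_odd (mu x $$ (i mod 2, j mod 2)) \<longleftrightarrow> odd j"
    and hi_mu: "hi (digit_of (mu x $$ (i mod 2, j mod 2))) \<longleftrightarrow>
      (if odd j then row_odd x \<noteq> col_odd x else hi (digit_of x))"
    and lo_mu: "lo (digit_of (mu x $$ (i mod 2, j mod 2))) \<longleftrightarrow>
      (if even i then row_odd x \<noteq> odd j else lo (digit_of x))"
  by (cases i rule: mod_2_cases; cases j rule: mod_2_cases; cases x;
      simp add: row_odd_def col_odd_def hi_def lo_def)+

lemma T_Suc: "T (Suc k) = apply_subst mu (T k)"
  by (simp add: T_def)

lemma dim_T [simp]: "dim_row (T k) = 2 ^ k" "dim_col (T k) = 2 ^ k"
proof (induction k)
  case 0
  show "dim_row (T 0) = 2 ^ 0" "dim_col (T 0) = 2 ^ 0"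
    by (simp_all add: T_def)
next
  case (Suc k)
  then show "dim_row (T (Suc k)) = 2 ^ Suc k" "dim_col (T (Suc k)) = 2 ^ Suc k"
    by (simp_all add: T_Suc apply_subst_def)
qed

lemma T_index:
  assumes "i < 2 ^ Suc k" "j < 2 ^ Suc k"
  shows "T (Suc k) $$ (i, j) = mu (T k $$ (i div 2, j div 2)) $$ (i mod 2, j mod 2)"
  using assms by (simp add: T_Suc apply_subst_def)

lemma apply_subst_phi_T: "apply_subst phi (T k) = map_mat digit_of (T (Suc k))"
  by (rule eq_matI) (auto simp: apply_subst_def T_Suc phi_index)

lemma row_odd_T:
  assumes "i < 2 ^ Suc k" "j < 2 ^ Suc k"
  shows "row_odd (T (Suc k) $$ (i, j)) \<longleftrightarrow> odd i"
  by (simp add: T_index[OF assms] row_odd_mu)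

text \<open>\<open>T 0\<close> is left out: its only entry \<open>LN\<close> stands in column 0, yet
  \<open>col_odd LN\<close> holds.\<close>

lemma col_odd_T:
  assumes "i < 2 ^ Suc k" "j < 2 ^ Suc k"
  shows "col_odd (T (Suc k) $$ (i, j)) \<longleftrightarrow> odd j"
  by (simp add: T_index[OF assms] col_odd_mu)

section \<open>Bits of the digits by position\<close>

abbreviation hi_T :: "nat \<Rightarrow> nat \<Rightarrow> nat \<Rightarrow> bool" where
  "hi_T k i j \<equiv> hi (digit_of (T k $$ (i, j)))"

abbreviation lo_T :: "nat \<Rightarrow> nat \<Rightarrow> nat \<Rightarrow> bool" where
  "lo_T k i j \<equiv> lo (digit_of (T k $$ (i, j)))"

lemma
  assumes "i < 2 ^ Suc k" "j < 2 ^ Suc k"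
  shows hi_T_Suc: "hi_T (Suc k) i j \<longleftrightarrow>
      (if odd j then row_odd (T k $$ (i div 2, j div 2)) \<noteq> col_odd (T k $$ (i div 2, j div 2))
       else hi_T k (i div 2) (j div 2))"
    and lo_T_Suc: "lo_T (Suc k) i j \<longleftrightarrow>
      (if even i then row_odd (T k $$ (i div 2, j div 2)) \<noteq> odd j
       else lo_T k (i div 2) (j div 2))"
  by (simp_all only: T_index[OF assms] hi_mu lo_mu)

lemma half_less: "i div 2 < 2 ^ Suc k" if "i < 2 ^ Suc (Suc k)" for i :: nat
  using that by auto

text \<open>The bit needs the row parity of the parent, which is read off its position in
  \<open>T (Suc k)\<close>; hence two levels.\<close>

lemma lo_T_even_row:
  assumes "i < 2 ^ Suc (Suc k)" "j < 2 ^ Suc (Suc k)" "even i"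
  shows "lo_T (Suc (Suc k)) i j \<longleftrightarrow> odd (i div 2 + j)"
  using assms(3)
  by (auto simp: lo_T_Suc[OF assms(1,2)] row_odd_T[OF half_less half_less, OF assms(1,2)])

text \<open>Both entries lie in one block, and odd rows inherit the low bit of the parent.\<close>

lemma lo_T_odd_row:
  assumes "i < 2 ^ Suc k" "Suc j < 2 ^ Suc k" "odd i" "even j"
  shows "lo_T (Suc k) i (Suc j) = lo_T (Suc k) i j"
proof -
  have "j < 2 ^ Suc k"
    using assms(2) by simp
  then show ?thesis
    using assms by (simp add: lo_T_Suc del: power_Suc)
qed

lemma hi_T_odd_col:
  assumes "i < 2 ^ Suc (Suc k)" "j < 2 ^ Suc (Suc k)" "odd j"
  shows "hi_T (Suc (Suc k)) i j \<longleftrightarrow> odd (i div 2 + j div 2)"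
  using assms(3)
  by (auto simp: hi_T_Suc[OF assms(1,2)] row_odd_T[OF half_less half_less, OF assms(1,2)]
      col_odd_T[OF half_less half_less, OF assms(1,2)])

text \<open>Both entries lie in one block, where the high bit depends only on the parent and the
  column.\<close>

lemma hi_T_even_row:
  assumes "Suc i < 2 ^ Suc k" "j < 2 ^ Suc k" "even i"
  shows "hi_T (Suc k) (Suc i) j = hi_T (Suc k) i j"
proof -
  have "i < 2 ^ Suc k"
    using assms(1) by simp
  then show ?thesis
    using assms by (simp add: hi_T_Suc del: power_Suc)
qed

lemma hi_T_step_odd_col:
  assumes "Suc i < 2 ^ Suc (Suc k)" "j < 2 ^ Suc (Suc k)" "odd i" "odd j"
  shows "hi_T (Suc (Suc k)) (Suc i) j \<noteq> hi_T (Suc (Suc k)) i j"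
proof -
  have "i < 2 ^ Suc (Suc k)"
    using assms(1) by simp
  then show ?thesis
    using assms by (simp add: hi_T_odd_col del: power_Suc)
qed

text \<open>Even columns inherit the high bits of the parents. For even \<open>i div 2\<close> the
  two parents share a block themselves and agree by \<open>hi_T_even_row\<close>.\<close>

lemma hi_T_step_even_col:
  assumes "Suc i < 2 ^ Suc (Suc k)" "j < 2 ^ Suc (Suc k)" "odd i" "even j"
    and "hi_T (Suc (Suc k)) (Suc i) j \<noteq> hi_T (Suc (Suc k)) i j"
  shows "odd (i div 2)"
proof
  assume "even (i div 2)"
  moreover have "Suc (i div 2) < 2 ^ Suc k" "i < 2 ^ Suc (Suc k)"
    using half_less[OF assms(1)] assms(1,3) by simp_all
  ultimately show False
    using assms hi_T_even_row[of "i div 2" k "j div 2"] half_less[of j k]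
    by (simp add: hi_T_Suc[of _ "Suc k"] del: power_Suc)
qed

section \<open>Parities recovered from a 3 x 3 window\<close>

locale same_digits =
  fixes k r c k' r' c' :: nat
  assumes bounds: "r + 3 \<le> 2 ^ Suc (Suc k)" "c + 3 \<le> 2 ^ Suc (Suc k)"
      "r' + 3 \<le> 2 ^ Suc (Suc k')" "c' + 3 \<le> 2 ^ Suc (Suc k')"
    and digits: "\<And>i j. i < 3 \<Longrightarrow> j < 3 \<Longrightarrow>
      digit_of (T (Suc (Suc k)) $$ (r + i, c + j)) = digit_of (T (Suc (Suc k')) $$ (r' + i, c' + j))"
begin

lemma even_row:
  assumes "even r"
  shows "even r'"
proof (rule ccontr)
  assume "odd r'"
  \<comment> \<open>Moves to an even column, where a pair of equal low bits starts in row
    \<open>r'\<close>; \<open>j < 2\<close> keeps the pair in the window.\<close>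
  define j where "j = c' mod 2"
  have j: "j < 2" "even (c' + j)"
    by (auto simp: j_def)
  have "lo_T (Suc (Suc k')) r' (Suc (c' + j)) = lo_T (Suc (Suc k')) r' (c' + j)"
    using j bounds \<open>odd r'\<close> by (intro lo_T_odd_row) auto
  moreover have "lo_T (Suc (Suc k)) r (Suc (c + j)) \<noteq> lo_T (Suc (Suc k)) r (c + j)"
    using j bounds \<open>even r\<close> by (simp add: lo_T_even_row del: power_Suc)
  ultimately show False
    using digits[of 0 j] digits[of 0 "Suc j"] j by simp
qed

lemma odd_col:
  assumes "even r = even r'" "odd c"
  shows "odd c'"
proof
  assume "even c'"
  \<comment> \<open>Picks the odd row among the first two, so that the row below is still in the
    window.\<close>
  define i where "i = (if odd r then 0 else 1 :: nat)"
  define a where "a = r + i"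
  define a' where "a' = r' + i"
  have i: "i < 2" "odd a" "odd a'"
    using assms by (auto simp: i_def a_def a'_def)
  have digit: "digit_of (T (Suc (Suc k)) $$ (a, c + j)) = digit_of (T (Suc (Suc k')) $$ (a', c' + j))"
    "digit_of (T (Suc (Suc k)) $$ (Suc a, c + j)) = digit_of (T (Suc (Suc k')) $$ (Suc a', c' + j))"
    if "j < 3" for j
    using digits[of i j] digits[of "Suc i" j] i that by (simp_all add: a_def a'_def)
  have less: "Suc a < 2 ^ Suc (Suc k)" "c + 1 < 2 ^ Suc (Suc k)" "c < 2 ^ Suc (Suc k)"
    "Suc a' < 2 ^ Suc (Suc k')" "c' + 1 < 2 ^ Suc (Suc k')" "c' < 2 ^ Suc (Suc k')"
    using bounds i(1) by (auto simp: a_def a'_def)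
  have "hi_T (Suc (Suc k)) (Suc a) c \<noteq> hi_T (Suc (Suc k)) a c"
    using hi_T_step_odd_col less i \<open>odd c\<close> by blast
  then have "hi_T (Suc (Suc k')) (Suc a') c' \<noteq> hi_T (Suc (Suc k')) a' c'"
    using digit[of 0] by simp
  then have odd': "odd (a' div 2)"
    using hi_T_step_even_col less i \<open>even c'\<close> by blast
  \<comment> \<open>One column to the right the windows swap roles.\<close>
  have "hi_T (Suc (Suc k')) (Suc a') (c' + 1) \<noteq> hi_T (Suc (Suc k')) a' (c' + 1)"
    using less i \<open>even c'\<close> by (intro hi_T_step_odd_col) auto
  then have "hi_T (Suc (Suc k)) (Suc a) (c + 1) \<noteq> hi_T (Suc (Suc k)) a (c + 1)"
    using digit[of 1] by simp
  then have "odd (a div 2)"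
    using less i \<open>odd c\<close> by (intro hi_T_step_even_col[of a k "c + 1"]) auto
  \<comment> \<open>\<open>Suc a\<close> and \<open>Suc a'\<close> are divisible by 4, so the low
    bits there are the parities of \<open>c\<close> and \<open>c'\<close>, which differ.\<close>
  then have "lo_T (Suc (Suc k)) (Suc a) c"
    using less i \<open>odd c\<close> by (simp add: lo_T_even_row del: power_Suc)
  moreover have "\<not> lo_T (Suc (Suc k')) (Suc a') c'"
    using less i \<open>even c'\<close> odd' by (simp add: lo_T_even_row del: power_Suc)
  ultimately show False
    using digit[of 0] by simp
qed

end

lemma same_digits_parity:
  assumes "same_digits k r c k' r' c'"
  shows "even r = even r'" "even c = even c'"
proof -
  interpret same_digits k r c k' r' c' by fact
  interpret sym: same_digits k' r' c' k r c
    by unfold_locales (use bounds digits in auto)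
  show row: "even r = even r'"
    using even_row sym.even_row by blast
  show "even c = even c'"
    using odd_col sym.odd_col row by blast
qed

section \<open>Passing to sets of patterns\<close>

lemma patterns_map_mat: "patterns (map_mat f X) m n = map_mat f ` patterns X m n"
proof -
  have window: "mat m n (\<lambda>(i, j). map_mat f X $$ (r + i, c + j)) =
      map_mat f (mat m n (\<lambda>(i, j). X $$ (r + i, c + j)))"
    if "r + m \<le> dim_row X" "c + n \<le> dim_col X" for r c
    using that by (intro eq_matI) auto
  show ?thesis
    unfolding patterns_def
    by (auto simp: window) (blast, intro exI conjI, rule window[symmetric], simp_all)
qed

text \<open>The digits of \<open>T (Suc k)\<close> form the image of \<open>T k\<close> under
  \<open>phi\<close>, so only \<open>T 0\<close> lacks a counterpart, and it is too small to contain
  a pattern.\<close>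

lemma patterns_S_eq:
  assumes "n \<ge> 2"
  shows "patterns_S n n = map_mat digit_of ` patterns_T n n"
proof -
  have "patterns (T 0) n n = {}"
    using assms by (auto simp: patterns_def)
  then have "patterns_T n n = (\<Union>k. patterns (T (Suc k)) n n)"
    unfolding patterns_T_def by (auto, metis empty_iff not0_implies_Suc)
  then show ?thesis
    by (auto simp: patterns_S_def apply_subst_phi_T patterns_map_mat)
qed

lemma patterns_T_E:
  assumes "M \<in> patterns_T n n" "n \<ge> 3"
  obtains k r c where "r + n \<le> 2 ^ Suc (Suc k)" "c + n \<le> 2 ^ Suc (Suc k)"
    "M = mat n n (\<lambda>(i, j). T (Suc (Suc k)) $$ (r + i, c + j))"
proof -
  obtain l r c where l: "r + n \<le> 2 ^ l" "c + n \<le> 2 ^ l"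
    "M = mat n n (\<lambda>(i, j). T l $$ (r + i, c + j))"
    using assms(1) by (auto simp: patterns_T_def patterns_def)
  have "l \<noteq> 0" "l \<noteq> Suc 0"
    using l(1) assms(2) by (intro notI, simp)+
  then obtain k where "l = Suc (Suc k)"
    by (metis not0_implies_Suc)
  then show thesis
    using l that by blast
qed

lemma inj_on_digits_patterns_T:
  assumes "n \<ge> 3"
  shows "inj_on (map_mat digit_of) (patterns_T n n)"
proof (rule inj_onI)
  fix M M'
  assume M: "M \<in> patterns_T n n" and M': "M' \<in> patterns_T n n"
    and eq: "map_mat digit_of M = map_mat digit_of M'"
  obtain k r c where k: "r + n \<le> 2 ^ Suc (Suc k)" "c + n \<le> 2 ^ Suc (Suc k)"
    and M_eq: "M = mat n n (\<lambda>(i, j). T (Suc (Suc k)) $$ (r + i, c + j))"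
    using M assms by (rule patterns_T_E)
  obtain k' r' c' where k': "r' + n \<le> 2 ^ Suc (Suc k')" "c' + n \<le> 2 ^ Suc (Suc k')"
    and M'_eq: "M' = mat n n (\<lambda>(i, j). T (Suc (Suc k')) $$ (r' + i, c' + j))"
    using M' assms by (rule patterns_T_E)
  have digits: "digit_of (T (Suc (Suc k)) $$ (r + i, c + j)) =
      digit_of (T (Suc (Suc k')) $$ (r' + i, c' + j))" if "i < n" "j < n" for i j
    using arg_cong[OF eq, of "\<lambda>A. A $$ (i, j)"] that by (simp add: M_eq M'_eq)
  have "same_digits k r c k' r' c'"
    by unfold_locales (use k k' digits assms in auto)
  note parity = same_digits_parity[OF this]
  show "M = M'"
  proof (rule eq_matI)
    fix i j
    assume "i < dim_row M'" "j < dim_col M'"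
    then have ij: "i < n" "j < n"
      by (simp_all add: M'_eq)
    have "T (Suc (Suc k)) $$ (r + i, c + j) = T (Suc (Suc k')) $$ (r' + i, c' + j)"
      using k k' ij parity digits[OF ij]
      by (intro letter_eqI) (simp_all add: row_odd_T col_odd_T del: power_Suc)
    then show "M $$ (i, j) = M' $$ (i, j)"
      using ij by (simp add: M_eq M'_eq)
  qed (simp_all add: M_eq M'_eq)
qed

theorem theorem2:
  fixes n :: nat
  assumes "n \<ge> 3"
  shows "card (patterns_T n n) = card (patterns_S n n)"
  using assms by (simp add: patterns_S_eq card_image inj_on_digits_patterns_T)

end
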